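(* There exists a countable two-dimensional sofic shift $X$ and a sequence $(x_i)_{i \geq 1}$ of points of $X$ with $x_i \succ x_{i+1}$ for all $i \geq 1$ (an infinite strictly descending chain in the subpattern order).
   Context: A two-dimensional sofic shift is the image of a two-dimensional subshift of finite type (configurations in $S^{\mathbb{Z}^2}$ avoiding a finite set of forbidden finite patterns) under a block map (a continuous map commuting with the shifts). For configurations $x,y$, $x \succcurlyeq y$ means every finite pattern occurring in $y$ also occurs in $x$; $x \succ y$ means $x \succcurlyeq y$ but not $y \succcurlyeq x$. *)

theory Defs
  imports "HOL-Analysis.Analysis"
begin

text \<open>Configurations on Z^2; symbols are natural numbers, an alphabet is {..<n}.
  The topology on configurations is the product topology (Function_Topology),
  nat carrying its (discrete) standard topology.\<close>

type_synonym cfg = "int \<times> int \<Rightarrow> nat"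

definition shift :: "int \<times> int \<Rightarrow> cfg \<Rightarrow> cfg" where
  "shift v x = (\<lambda>(i, j). x (i + fst v, j + snd v))"

definition fullshift :: "nat \<Rightarrow> cfg set" where
  "fullshift n = {x. \<forall>u. x u < n}"

definition occurs :: "(int \<times> int \<rightharpoonup> nat) \<Rightarrow> cfg \<Rightarrow> bool" where
  "occurs p x \<longleftrightarrow> (\<exists>v. \<forall>u\<in>dom p. p u = Some (shift v x u))"

definition subpat_ge :: "cfg \<Rightarrow> cfg \<Rightarrow> bool" where
  "subpat_ge x y \<longleftrightarrow> (\<forall>p. finite (dom p) \<longrightarrow> occurs p y \<longrightarrow> occurs p x)"

definition subpat_gt :: "cfg \<Rightarrow> cfg \<Rightarrow> bool" where
  "subpat_gt x y \<longleftrightarrow> subpat_ge x y \<and> \<not> subpat_ge y x"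

definition is_SFT :: "nat \<Rightarrow> cfg set \<Rightarrow> bool" where
  "is_SFT n Y \<longleftrightarrow> (\<exists>F. finite F \<and> (\<forall>p\<in>F. finite (dom p)) \<and>
     Y = {x \<in> fullshift n. \<forall>p\<in>F. \<not> occurs p x})"

definition block_map :: "cfg set \<Rightarrow> (cfg \<Rightarrow> cfg) \<Rightarrow> bool" where
  "block_map Y \<Phi> \<longleftrightarrow> continuous_on Y \<Phi> \<and>
     (\<forall>v. \<forall>x\<in>Y. \<Phi> (shift v x) = shift v (\<Phi> x))"

definition sofic :: "nat \<Rightarrow> cfg set \<Rightarrow> bool" where
  "sofic m X \<longleftrightarrow> (\<exists>n Y \<Phi>. is_SFT n Y \<and> block_map Y \<Phi> \<and> \<Phi> ` Y \<subseteq> fullshift m \<and> X = \<Phi> ` Y)"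

end

theory Submission
  imports Defs
begin

text \<open>
  Let \<open>s(m)\<close> be the binary digit sum and let \<open>x\<^sub>i\<close> be the configuration consisting of one base row
  on which marks are placed at distances \<open>s(0) + 1 + i, s(1) + 1 + i, s(2) + 1 + i, \<dots>\<close>, with no mark
  to the left of the first. As \<open>s(2\<^sup>d + m) = s(m) + 1\<close> for \<open>m < 2\<^sup>d\<close>, the stretch of \<open>x\<^sub>i\<close> after
  mark number \<open>2\<^sup>d\<close> is a prefix of \<open>x\<^sub>i\<^sub>+\<^sub>1\<close>, and it is preceded by a gap of size \<open>s(2\<^sup>d - 1) + 1 + i\<close>
  \<open>= d + 1 + i\<close>; so every pattern of \<open>x\<^sub>i\<^sub>+\<^sub>1\<close> occurs in \<open>x\<^sub>i\<close>, while two marks at distance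
  \<open>i + 1\<close> occur only in the latter.

  The sequences of marks are enforced by hidden bits above the base row. Over mark \<open>m\<close> stands a bar
  whose height is the 2-adic valuation \<open>v(m)\<close>; this is local because on each level every other bar
  ends. Diagonal and horizontal signals check the identity \<open>s(m) + v(m) = s(m - 1) + 1\<close>
  between consecutive gaps. The hidden bits are erased, so only the base row matters. If there were
  no leftmost mark, a mark with the smallest gap would have a predecessor on its top level, and the
  gap of that predecessor would be smaller still. Hence a leftmost mark exists, and a row with at
  least two marks is determined by the first two, which leaves only countably many rows.
\<close>

section \<open>Tableaux over a set of marks\<close>

definition consec :: "(int \<Rightarrow> bool) \<Rightarrow> int \<Rightarrow> int \<Rightarrow> bool" where
  "consec Q p q \<longleftrightarrow> Q p \<and> Q q \<and> p < q \<and> (\<forall>x. p < x \<and> x < q \<longrightarrow> \<not> Q x)"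

lemma consec_pred_exists:
  assumes "Q p" "p < q" "Q q"
  obtains p' where "p \<le> p'" "consec Q p' q"
proof -
  let ?S = "{p..<q} \<inter> Collect Q"
  have f: "finite ?S" "p \<in> ?S" using assms by auto
  have m: "Max ?S \<in> ?S" using f Max_in by blast
  have "\<not> Q x" if "Max ?S < x" "x < q" for x
  proof
    assume "Q x"
    then have "x \<in> ?S" using that m by auto
    then show False using Max_ge[OF f(1)] that by fastforce
  qed
  then have "consec Q (Max ?S) q" using m assms by (auto simp: consec_def)
  moreover have "p \<le> Max ?S" using m by auto
  ultimately show ?thesis using that by blast
qed

lemma consec_succ_exists:
  assumes "Q p" "p < q" "Q q"
  obtains q' where "q' \<le> q" "consec Q p q'"
proof -
  let ?S = "{p<..q} \<inter> Collect Q"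
  have f: "finite ?S" "q \<in> ?S" using assms by auto
  have m: "Min ?S \<in> ?S" using f Min_in by blast
  have "\<not> Q x" if "p < x" "x < Min ?S" for x
  proof
    assume "Q x"
    then have "x \<in> ?S" using that m by auto
    then show False using Min_le[OF f(1)] that by fastforce
  qed
  then have "consec Q p (Min ?S)" using m assms by (auto simp: consec_def)
  moreover have "Min ?S \<le> q" using m by auto
  ultimately show ?thesis using that by blast
qed

lemma last_before_exists:
  assumes "Q p" "p < (x :: int)"
  obtains p' k where "p \<le> p'" "Q p'" "x = p' + 1 + int k" "\<And>z. p' < z \<Longrightarrow> z < x \<Longrightarrow> \<not> Q z"
proof -
  \<comment> \<open>Adjoining \<open>x\<close> to the set makes the predecessor lemma available for
    an arbitrary column.\<close>
  have "Q p \<or> p = x" "p < x" "Q x \<or> x = x" using assms by auto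
  then obtain p' where p': "p \<le> p'" "consec (\<lambda>z. Q z \<or> z = x) p' x"
    by (rule consec_pred_exists[where Q = "\<lambda>z. Q z \<or> z = x"])
  show ?thesis
  proof (rule that[of p' "nat (x - p' - 1)"])
    show "p \<le> p'" by fact
    show "Q p'" "x = p' + 1 + int (nat (x - p' - 1))"
      using p' by (auto simp: consec_def)
    show "\<not> Q z" if "p' < z" "z < x" for z using p' that by (auto simp: consec_def)
  qed
qed

text \<open>
  The columns are integers and the levels above the base row are natural numbers; \<open>P\<close> is the set of
  marks. \<open>bar x r\<close>: the bar over \<open>x\<close> reaches level \<open>r\<close>; \<open>b\<close>: along each level this bit flips at
  every bar, and the bars at which it is false end there; \<open>E x r\<close>: the last mark strictly left of \<open>x\<close>
  is more than \<open>r\<close> columns away; \<open>T x r\<close>: \<open>r\<close> is less than the height of the bar over that mark plus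
  its distance to \<open>x\<close>; \<open>C x\<close>: the value of \<open>E\<close> at that mark. The implication \<open>T_imp_C\<close> at unmarked
  columns gives every mark that has a predecessor also a successor.
\<close>

locale tableau =
  fixes P :: "int set" and bar b E T C :: "int \<Rightarrow> nat \<Rightarrow> bool"
  assumes bar_0: "bar x 0 \<longleftrightarrow> x \<in> P"
    and E_0: "E x 0"
    and T_0: "T x 0"
    and bar_Suc: "bar x (Suc r) \<longleftrightarrow> bar x r \<and> b x r"
    and b_step: "b (x + 1) r \<longleftrightarrow> b x r \<noteq> bar (x + 1) r"
    and E_step: "E (x + 1) (Suc r) \<longleftrightarrow> x \<notin> P \<and> E x r"
    and T_step: "T (x + 1) (Suc r) \<longleftrightarrow> (if x \<in> P then bar x (Suc r) else T x r)"
    and C_step: "C (x + 1) r \<longleftrightarrow> (if x \<in> P then E x r else C x r)"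
    and T_imp_C: "T x (Suc r) \<Longrightarrow> C x r"
    and C_imp_T: "x \<in> P \<Longrightarrow> C x r \<Longrightarrow> T x (Suc r)"
begin

section \<open>Signals between marks and heights of bars\<close>

lemma bar_antimono: "bar x s \<Longrightarrow> r \<le> s \<Longrightarrow> bar x r"
  by (induction s) (auto simp: bar_Suc le_Suc_eq)

lemma bar_mark: "bar x r \<Longrightarrow> x \<in> P"
  using bar_antimono[of x r 0] bar_0 by simp

lemma E_iff: "E x r \<longleftrightarrow> (\<forall>k. 1 \<le> k \<and> k \<le> r \<longrightarrow> x - int k \<notin> P)"
proof (induction r arbitrary: x)
  case 0
  then show ?case by (simp add: E_0)
next
  case (Suc r)
  have "E x (Suc r) \<longleftrightarrow> x - 1 \<notin> P \<and> (\<forall>k. 1 \<le> k \<and> k \<le> r \<longrightarrow> x - 1 - int k \<notin> P)"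
    using E_step[of "x - 1" r] Suc[of "x - 1"] by simp
  also have "\<dots> \<longleftrightarrow> (\<forall>k. 1 \<le> k \<and> k \<le> Suc r \<longrightarrow> x - int k \<notin> P)" (is "?L \<longleftrightarrow> ?R")
  proof
    assume L: ?L
    show ?R
    proof (intro allI impI)
      fix k :: nat assume k: "1 \<le> k \<and> k \<le> Suc r"
      show "x - int k \<notin> P"
      proof (cases "k = 1")
        case False
        then have "1 \<le> k - 1 \<and> k - 1 \<le> r" using k by auto
        then have "x - 1 - int (k - 1) \<notin> P" using L by blast
        then show ?thesis using k by (simp add: of_nat_diff)
      qed (use L in simp)
    qed
  next
    assume R: ?R
    have "x - 1 - int k \<notin> P" if "k \<le> r" for k
      using R[rule_format, of "Suc k"] that by (simp add: algebra_simps)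
    then show ?L using R[rule_format, of 1] by auto
  qed
  finally show ?case .
qed

text \<open>Each blank column lifts the signal by one level and \<open>T_0\<close> refills the base
  level. The truncated subtraction records this: levels up to \<open>k\<close> are true, like
  \<open>bar p 0\<close>.\<close>

lemma T_after:
  assumes "p \<in> P" "\<And>z. p < z \<Longrightarrow> z < p + 1 + int k \<Longrightarrow> z \<notin> P"
  shows "T (p + 1 + int k) r \<longleftrightarrow> bar p (r - k)"
  using assms(2)
proof (induction k arbitrary: r)
  case 0
  then show ?case using T_step[of p] T_0 assms(1) bar_0 by (cases r) auto
next
  case (Suc k)
  have "p + 1 + int k \<notin> P" using Suc.prems by auto
  moreover have "T (p + 1 + int k) r \<longleftrightarrow> bar p (r - k)" for r
    using Suc by auto
  ultimately show ?case
    using T_step[of "p + 1 + int k"] T_0 assms(1) bar_0 by (cases r) (auto simp: algebra_simps)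
qed

lemma C_after:
  assumes "p \<in> P" "\<And>z. p < z \<Longrightarrow> z < p + 1 + int k \<Longrightarrow> z \<notin> P"
  shows "C (p + 1 + int k) r \<longleftrightarrow> E p r"
  using assms(2)
proof (induction k)
  case 0
  then show ?case using C_step[of p] assms(1) by auto
next
  case (Suc k)
  have "p + 1 + int k \<notin> P" using Suc.prems by auto
  moreover have "C (p + 1 + int k) r \<longleftrightarrow> E p r"
    using Suc by auto
  ultimately show ?case
    using C_step[of "p + 1 + int k"] by (auto simp: algebra_simps)
qed

lemma b_between:
  assumes "\<And>z. p < z \<Longrightarrow> z \<le> p + int k \<Longrightarrow> \<not> bar z r"
  shows "b (p + int k) r \<longleftrightarrow> b p r"
  using assms
proof (induction k)
  case (Suc k)
  have "\<not> bar (p + int k + 1) r" using Suc.prems by auto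
  then show ?case using b_step[of "p + int k" r] Suc by (simp add: algebra_simps)
qed simp

lemma b_consec:
  assumes "consec (\<lambda>x. bar x r) p q"
  shows "b q r \<longleftrightarrow> \<not> b p r"
proof -
  have "b (p + int (nat (q - 1 - p))) r \<longleftrightarrow> b p r"
    by (rule b_between) (use assms in \<open>auto simp: consec_def\<close>)
  then show ?thesis using assms b_step[of "q - 1" r] by (auto simp: consec_def)
qed

text \<open>The number of blank columns up to the next mark, one less than the distance; without a
  next mark the value is unspecified.\<close>

definition gap :: "int \<Rightarrow> nat" where
  "gap p = (LEAST k. p + 1 + int k \<in> P)"

lemma consec_gap:
  assumes "consec (\<lambda>x. x \<in> P) p q"
  shows "q = p + 1 + int (gap p)"
proof -
  have "gap p = nat (q - p - 1)" unfolding gap_def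
    by (rule Least_equality) (use assms in \<open>auto simp: consec_def not_less[symmetric]\<close>)
  then show ?thesis using assms by (auto simp: consec_def)
qed

lemma E_consec:
  assumes "consec (\<lambda>x. x \<in> P) p q"
  shows "E q r \<longleftrightarrow> r \<le> gap p"
proof -
  note q = consec_gap[OF assms]
  have "q - int k \<notin> P" if "1 \<le> k" "k \<le> gap p" for k
    using assms q that by (auto simp: consec_def)
  moreover have "q - int (Suc (gap p)) \<in> P" using assms q by (auto simp: consec_def)
  ultimately show ?thesis unfolding E_iff by (metis le_trans not_less_eq_eq le_add1 plus_1_eq_Suc)
qed

text \<open>If \<open>q\<close> were the last mark, its \<open>T\<close> signal would rise forever
  through the blank columns, whereas \<open>C\<close> there is bounded by the gap before
  \<open>q\<close>, against \<open>T_imp_C\<close>.\<close>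

lemma next_mark_exists:
  assumes "p \<in> P" "q \<in> P" "p < q"
  obtains q' where "consec (\<lambda>x. x \<in> P) q q'"
proof -
  obtain p' where p': "consec (\<lambda>x. x \<in> P) p' q"
    using consec_pred_exists[of "\<lambda>x. x \<in> P" p q] assms by blast
  have "\<exists>z \<in> P. q < z"
  proof (rule ccontr)
    assume a: "\<not> (\<exists>z \<in> P. q < z)"
    \<comment> \<open>The first level on which \<open>E q\<close> is false.\<close>
    let ?r = "Suc (gap p')"
    have "T (q + 1 + int (Suc ?r)) (Suc ?r) \<longleftrightarrow> bar q (Suc ?r - Suc ?r)"
      by (rule T_after) (use a assms in auto)
    then have "C (q + 1 + int (Suc ?r)) ?r" using T_imp_C assms bar_0 by simp
    moreover have "C (q + 1 + int (Suc ?r)) ?r \<longleftrightarrow> E q ?r"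
      by (rule C_after) (use a assms in auto)
    ultimately show False using E_consec[OF p'] by auto
  qed
  then show ?thesis using consec_succ_exists[of "\<lambda>x. x \<in> P" q] assms that by blast
qed

text \<open>At the mark after \<open>q\<close> the signals \<open>T\<close> and \<open>C\<close> are
  compared in both directions. This forces the height \<open>gap p + 1 - gap q\<close>, which is the
  identity between digit sums and valuation.\<close>

lemma bar_height:
  assumes "consec (\<lambda>x. x \<in> P) p q"
  shows "bar q s \<longleftrightarrow> s + gap q \<le> gap p + 1"
proof -
  have pq: "p \<in> P" "q \<in> P" "p < q" using assms by (auto simp: consec_def)
  obtain q' where q': "consec (\<lambda>x. x \<in> P) q q'" using next_mark_exists pq by blast
  have q'_eq: "q' = q + 1 + int (gap q)" by (rule consec_gap[OF q'])
  have none: "z \<notin> P" if "q < z" "z < q + 1 + int (gap q)" for z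
    using q' q'_eq that by (auto simp: consec_def)
  have "q' \<in> P" using q' by (auto simp: consec_def)
  then have "T q' (Suc r) \<longleftrightarrow> C q' r" for r using T_imp_C C_imp_T by blast
  then have key: "bar q (Suc r - gap q) \<longleftrightarrow> r \<le> gap p" for r
    using T_after[OF pq(2) none] C_after[OF pq(2) none] E_consec[OF assms] unfolding q'_eq by auto
  have "bar q 0" using pq bar_0 by simp
  show ?thesis
  proof (cases "s + gap q")
    case 0
    then show ?thesis using \<open>bar q 0\<close> by simp
  next
    case (Suc r)
    then have "Suc r - gap q = s" by simp
    then show ?thesis using key[of r] Suc by simp
  qed
qed

text \<open>Deleting every other mark reproduces the gap recursion one level higher: this is the
  substitution \<open>g \<mapsto> g, g + 1\<close> generating the binary digit sum.\<close>

lemma bar_height_level: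
  assumes "consec (\<lambda>x. bar x l) p q" "l \<le> s"
  shows "bar q s \<longleftrightarrow> s + gap q \<le> gap p + 1 + l"
  using assms
proof (induction l arbitrary: p q s)
  case 0
  then show ?case using bar_height[of p q s] by (simp add: bar_0)
next
  case (Suc l)
  let ?Q = "\<lambda>x. bar x l"
  have pq: "bar p (Suc l)" "bar q (Suc l)" "p < q"
    and none: "\<And>x. p < x \<Longrightarrow> x < q \<Longrightarrow> \<not> bar x (Suc l)"
    using Suc.prems(1) by (auto simp: consec_def)
  then have lev: "?Q p" "b p l" "?Q q" "b q l" by (auto simp: bar_Suc)
  \<comment> \<open>On level \<open>l\<close> the bit is true at \<open>p\<close> and
    \<open>q\<close> and flips at each bar, so exactly one bar \<open>c\<close> lies between them.
    It ends on level \<open>l\<close>, which fixes its gap.\<close>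
  obtain c where c: "c \<le> q" "consec ?Q p c" using consec_succ_exists[of ?Q p q] lev pq by blast
  have bc: "\<not> b c l" using b_consec[OF c(2)] lev by simp
  then have "c < q" using c lev by (cases "c = q") auto
  moreover have "?Q c" using c by (simp add: consec_def)
  ultimately obtain d where d: "d \<le> q" "consec ?Q c d"
    using consec_succ_exists[of ?Q c q] lev by blast
  have "b d l" using b_consec[OF d(2)] bc by simp
  then have "bar d (Suc l)" using d by (simp add: bar_Suc consec_def)
  moreover have "p < d" using c d by (auto simp: consec_def)
  ultimately have "d = q" using none[of d] d(1) by fastforce
  have "\<not> bar c (Suc l)" using bc by (simp add: bar_Suc)
  then have "gap c = gap p + 1"
    using Suc.IH[OF c(2), of l] Suc.IH[OF c(2), of "Suc l"] \<open>?Q c\<close> by auto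
  then show ?case using Suc.IH[OF d(2), of s] Suc.prems(2) \<open>d = q\<close> by auto
qed

lemma least_mark_exists:
  assumes "P \<noteq> {}"
  shows "\<exists>p\<in>P. \<forall>q\<in>P. p \<le> q"
proof (rule ccontr)
  assume a: "\<not> ?thesis"
  have unb0: "\<exists>p\<in>P. p < x" for x
  proof (rule ccontr)
    assume n: "\<not> (\<exists>p\<in>P. p < x)"
    obtain q where q: "q \<in> P" using assms by blast
    let ?S = "{x..q} \<inter> P"
    have "q \<in> ?S" using q n by force
    moreover have S: "finite ?S" by simp
    ultimately have M: "Min ?S \<in> ?S" by (intro Min_in) auto
    have "Min ?S \<le> z" if "z \<in> P" for z
    proof (cases "z \<le> q")
      case True
      then show ?thesis using Min_le[OF S] that n by force
    next
      case False
      then show ?thesis using M by simp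
    qed
    then show False using a M by blast
  qed
  \<comment> \<open>Of two consecutive bars on a level one continues upwards, so bars occur
    arbitrarily far left on every level.\<close>
  have unb: "\<exists>p<x. bar p l" for x l
  proof (induction l arbitrary: x)
    case 0
    then show ?case using unb0 bar_0 by auto
  next
    case (Suc l)
    obtain q where q: "q < x" "bar q l" using Suc by blast
    obtain p' where "p' < q" "bar p' l" using Suc by blast
    then obtain p where p: "consec (\<lambda>x. bar x l) p q"
      using consec_pred_exists[of "\<lambda>x. bar x l" p' q] q by blast
    then have "bar p l" "p < q" by (auto simp: consec_def)
    then show ?case using b_consec[OF p] q bar_Suc by (cases "b q l") fastforce+
  qed
  obtain q where q: "q \<in> P" "\<And>p. p \<in> P \<Longrightarrow> gap q \<le> gap p"
    using assms ex_has_least_nat[of "\<lambda>p. p \<in> P" _ gap] by blast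
  obtain p0 where p0: "consec (\<lambda>x. x \<in> P) p0 q"
    using unb0[of q] consec_pred_exists[of "\<lambda>x. x \<in> P" _ q] q by blast
  \<comment> \<open>The bar over \<open>q\<close> is finite and so has a top level \<open>l\<close>.
    For the predecessor \<open>p\<close> on that level the height formula gives
    \<open>gap q = gap p + 1\<close>.\<close>
  have "\<not> bar q (gap p0 + 2)" using bar_height[OF p0] by simp
  moreover have "bar q 0" using q bar_0 by simp
  ultimately obtain l where l: "bar q l" "\<not> bar q (Suc l)"
    using nat_induct[of "bar q" "gap p0 + 2"] by blast
  obtain p where p: "consec (\<lambda>x. bar x l) p q"
    using unb[of q l] consec_pred_exists[of "\<lambda>x. bar x l" _ q] l by blast
  then have "p \<in> P" by (auto simp: consec_def intro: bar_mark)
  moreover have "gap p < gap q"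
    using bar_height_level[OF p, of l] bar_height_level[OF p, of "Suc l"] l by auto
  ultimately show False using q(2)[of p] by simp
qed

section \<open>Determinism and countability\<close>

lemma bar_first_mark:
  assumes "consec (\<lambda>x. x \<in> P) p q" "\<And>z. z < p \<Longrightarrow> z \<notin> P"
  shows "bar p r"
proof -
  have q: "q = p + 1 + int (gap p)" by (rule consec_gap[OF assms(1)])
  have pP: "p \<in> P" "q \<in> P" using assms by (auto simp: consec_def)
  have none: "z \<notin> P" if "p < z" "z < p + 1 + int (gap p)" for z
    using assms(1) q that by (auto simp: consec_def)
  \<comment> \<open>No mark lies left of \<open>p\<close>, so \<open>E\<close> holds at
    \<open>p\<close> on all levels. The check at \<open>q\<close> turns this into an infinite bar,
    as 0 has infinite valuation.\<close>
  have "E p (r + gap p)" using assms(2) by (auto simp: E_iff)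
  then have "C q (r + gap p)" using C_after[OF pP(1) none] q by simp
  then have "T q (Suc (r + gap p))" using C_imp_T pP by simp
  then have "bar p (Suc (r + gap p) - gap p)" using T_after[OF pP(1) none] q by simp
  then show ?thesis using bar_antimono by fastforce
qed

end

text \<open>Otherwise \<open>x + 1\<close> is a mark only in the first tableau, while both carry the
  same signals there. \<open>C\<close> on level \<open>r\<close> forces \<open>T\<close> on level
  \<open>r + 1\<close> by the mark in \<open>P\<close>; in the second tableau \<open>T\<close> moves
  on diagonally and forces \<open>C\<close> on level \<open>r + 1\<close>. So \<open>E\<close> would
  hold on all levels at the last mark \<open>m\<close> before \<open>x + 1\<close>, although
  \<open>p\<close> lies left of \<open>m\<close>.\<close>

lemma tableau_marks_extend:
  assumes "tableau P bar b E T C" "tableau P' bar' b' E' T' C'"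
    and first: "consec (\<lambda>x. x \<in> P) p q" "\<And>z. z < p \<Longrightarrow> z \<notin> P"
    and first': "consec (\<lambda>x. x \<in> P') p q" "\<And>z. z < p \<Longrightarrow> z \<notin> P'"
    and "q \<le> x" and agree: "\<And>z. z \<le> x \<Longrightarrow> z \<in> P \<longleftrightarrow> z \<in> P'"
    and "x + 1 \<in> P"
  shows "x + 1 \<in> P'"
proof (rule ccontr)
  assume notin: "x + 1 \<notin> P'"
  interpret t: tableau P bar b E T C by fact
  interpret t': tableau P' bar' b' E' T' C' by fact
  \<comment> \<open>The infinite bar over the first mark fixes the bit there; bars and bits from
    \<open>p\<close> to \<open>x\<close> are then determined level by level.\<close>
  have b: "b p r" "b' p r" for r
    using t.bar_first_mark[OF first, of "Suc r"] t'.bar_first_mark[OF first', of "Suc r"]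
    by (auto simp: t.bar_Suc t'.bar_Suc)
  have bar_b: "(\<forall>z\<le>x. bar z r \<longleftrightarrow> bar' z r) \<and> (\<forall>k. p + int k \<le> x \<longrightarrow> (b (p + int k) r \<longleftrightarrow> b' (p + int k) r))"
    for r
  proof (induction r)
    have row: "b (p + int k) r \<longleftrightarrow> b' (p + int k) r"
      if "\<forall>z\<le>x. bar z r \<longleftrightarrow> bar' z r" "p + int k \<le> x" for k r
      using that(2)
    proof (induction k)
      case 0
      then show ?case using b by simp
    next
      case (Suc k)
      have "p + int k + 1 \<le> x" using Suc.prems by simp
      then have "bar (p + int k + 1) r \<longleftrightarrow> bar' (p + int k + 1) r" using that(1) by blast
      then show ?case using t.b_step[of "p + int k" r] t'.b_step[of "p + int k" r] Suc
        by (simp add: algebra_simps)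
    qed
    {
      case 0
      have "\<forall>z\<le>x. bar z 0 \<longleftrightarrow> bar' z 0" using agree t.bar_0 t'.bar_0 by simp
      then show ?case using row by blast
    next
      case (Suc r)
      have "bar z (Suc r) \<longleftrightarrow> bar' z (Suc r)" if "z \<le> x" for z
      proof (cases "z < p")
        case True
        then show ?thesis using t.bar_mark t'.bar_mark first(2) first'(2) by blast
      next
        case False
        then have "z = p + int (nat (z - p))" by simp
        then have "b z r \<longleftrightarrow> b' z r" using Suc that by metis
        then show ?thesis using Suc that by (simp add: t.bar_Suc t'.bar_Suc)
      qed
      then show ?case using row by blast
    }
  qed
  have "q \<in> P" "q < x + 1" using first \<open>q \<le> x\<close> by (auto simp: consec_def)
  then obtain m k where m: "q \<le> m" "m \<in> P" "x + 1 = m + 1 + int k"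
      and none: "\<And>z. m < z \<Longrightarrow> z < x + 1 \<Longrightarrow> z \<notin> P"
    using last_before_exists[of "\<lambda>z. z \<in> P" q "x + 1"] by metis
  have mx: "m \<le> x" "m \<in> P'" using m agree by auto
  have none': "z \<notin> P'" if "m < z" "z < x + 1" for z using none[OF that] agree[of z] that by simp
  have T_eq: "T (x + 1) r \<longleftrightarrow> T' (x + 1) r" for r
    unfolding m(3) using t.T_after[OF m(2), of k r] t'.T_after[OF mx(2), of k r] none none' m(3)
      bar_b[of "r - k"] mx by auto
  have E_eq: "E m r \<longleftrightarrow> E' m r" for r
    unfolding t.E_iff t'.E_iff using agree mx(1) by auto
  have C_m: "C (x + 1) r \<longleftrightarrow> E m r" "C' (x + 1) r \<longleftrightarrow> E m r" for r
    unfolding m(3) using t.C_after[OF m(2), of k r] t'.C_after[OF mx(2), of k r] none none' m(3)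
      E_eq by auto
  have "E m r" for r
  proof (induction r)
    case 0
    show ?case by (rule t.E_0)
  next
    case (Suc r)
    then have "T (x + 1) (Suc r)" using t.C_imp_T \<open>x + 1 \<in> P\<close> C_m by blast
    then have "T' (x + 1 + 1) (Suc (Suc r))" using T_eq t'.T_step[of "x + 1" "Suc r"] notin by (simp only: if_False)
    then have "C' (x + 1 + 1) (Suc r)" by (rule t'.T_imp_C)
    then show ?case using t'.C_step[of "x + 1"] notin C_m by simp
  qed
  then have "\<forall>k\<ge>1. m - int k \<notin> P" unfolding t.E_iff by blast
  moreover have "p < m" "p \<in> P" using m first by (auto simp: consec_def)
  ultimately show False by (auto dest: spec[of _ "nat (m - p)"])
qed

definition tableau_marks :: "int set set" where
  "tableau_marks = {P. \<exists>bar b E T C. tableau P bar b E T C}"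

lemma tableau_marks_unique:
  assumes "P \<in> tableau_marks" "P' \<in> tableau_marks"
    and first: "consec (\<lambda>x. x \<in> P) p q" "\<And>z. z < p \<Longrightarrow> z \<notin> P"
    and first': "consec (\<lambda>x. x \<in> P') p q" "\<And>z. z < p \<Longrightarrow> z \<notin> P'"
  shows "P = P'"
proof -
  obtain bar b E T C bar' b' E' T' C'
    where t: "tableau P bar b E T C" and t': "tableau P' bar' b' E' T' C'"
    using assms(1,2) unfolding tableau_marks_def by blast
  have agree: "\<forall>z\<le>q + int n. z \<in> P \<longleftrightarrow> z \<in> P'" for n
  proof (induction n)
    case 0
    have "z \<in> P \<longleftrightarrow> z \<in> P'" if "z \<le> q" for z
    proof (cases "z < p")
      case False
      then have "z = p \<or> p < z \<and> z < q \<or> z = q" using that by auto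
      then show ?thesis using first(1) first'(1) by (auto simp: consec_def)
    qed (use first(2) first'(2) in blast)
    then show ?case by simp
  next
    case (Suc n)
    have "q + int n + 1 \<in> P \<longleftrightarrow> q + int n + 1 \<in> P'"
      using tableau_marks_extend[OF t t' first first', of "q + int n"]
        tableau_marks_extend[OF t' t first' first, of "q + int n"] Suc by auto
    moreover have "z \<le> q + int n \<or> z = q + int n + 1" if "z \<le> q + int (Suc n)" for z
      using that by auto
    ultimately show ?case using Suc by blast
  qed
  have "z \<in> P \<longleftrightarrow> z \<in> P'" for z using agree[of "nat (z - q)"] by simp
  then show ?thesis by blast
qed

lemma countable_tableau_marks: "countable tableau_marks"
proof -
  define f where "f P p q \<longleftrightarrow> consec (\<lambda>x. x \<in> P) p q \<and> (\<forall>z<p. z \<notin> P)" for P p q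
  \<comment> \<open>\<open>g\<close> recovers a set from its first two marks; its values on other
    pairs are irrelevant.\<close>
  define g where "g pq = (THE P. P \<in> tableau_marks \<and> f P (fst pq) (snd pq))" for pq
  have "P \<in> {{}} \<union> range (\<lambda>p. {p}) \<union> range g" if P: "P \<in> tableau_marks" for P
  proof (cases "P = {}")
    case False
    obtain bar b E T C where "tableau P bar b E T C" using P unfolding tableau_marks_def by blast
    then obtain p where p: "p \<in> P" "\<And>q. q \<in> P \<Longrightarrow> p \<le> q"
      using tableau.least_mark_exists False by metis
    show ?thesis
    proof (cases "P = {p}")
      case False
      then obtain q' where "q' \<in> P" "p < q'" using p by force
      then obtain q where "consec (\<lambda>x. x \<in> P) p q"
        using consec_succ_exists[of "\<lambda>x. x \<in> P" p q'] p(1) by blast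
      then have f: "f P p q" using p unfolding f_def by force
      have "g (p, q) = P" unfolding g_def
        by (rule the_equality) (use P f tableau_marks_unique in \<open>auto simp: f_def\<close>)
      then show ?thesis by blast
    qed blast
  qed blast
  then have "tableau_marks \<subseteq> {{}} \<union> range (\<lambda>p. {p}) \<union> range g" by blast
  then show ?thesis by (rule countable_subset) auto
qed

section \<open>Configurations given by a window rule\<close>

text \<open>Local rules on 2 by 2 squares over any finite type, so that cells can be structured data
  and are coded as numbers only once.\<close>

definition window_cfgs :: "('a \<Rightarrow> 'a \<Rightarrow> 'a \<Rightarrow> 'a \<Rightarrow> bool) \<Rightarrow> (int \<times> int \<Rightarrow> 'a) set" where
  "window_cfgs R = {z. \<forall>i j. R (z (i, j)) (z (i + 1, j)) (z (i, j + 1)) (z (i + 1, j + 1))}"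

lemma sofic_window_cfgs:
  fixes R :: "'a \<Rightarrow> 'a \<Rightarrow> 'a \<Rightarrow> 'a \<Rightarrow> bool" and f :: "'a \<Rightarrow> nat"
  assumes fin: "finite (UNIV :: 'a set)" and f: "\<And>a. f a < m"
  shows "sofic m ((\<lambda>z u. f (z u)) ` window_cfgs R)"
proof -
  obtain e :: "'a \<Rightarrow> nat" and n where e: "bij_betw e UNIV {0..<n}"
    using ex_bij_betw_finite_nat[OF fin] by blast
  define d where "d = inv e"
  have de: "d (e a) = a" for a using e by (simp add: d_def bij_betw_def)
  have ed: "e (d k) = k" if "k < n" for k
    using e that unfolding d_def by (metis atLeastLessThan_iff bij_betw_imp_surj_on f_inv_into_f zero_le)
  have en: "e a < n" for a using e by (force simp: bij_betw_def)
  define w where "w a r u c = [(0 :: int, 0 :: int) \<mapsto> e a, (1, 0) \<mapsto> e r, (0, 1) \<mapsto> e u, (1, 1) \<mapsto> e c]"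
    for a r u c
  define Y where "Y = {y \<in> fullshift n. (\<lambda>u. d (y u)) \<in> window_cfgs R}"
  define F where "F = (\<lambda>(a, r, u, c). w a r u c) ` {(a, r, u, c). \<not> R a r u c}"
  have occ: "occurs (w a r u c) y \<longleftrightarrow> (\<exists>i j. y (i, j) = e a \<and> y (i + 1, j) = e r \<and>
      y (i, j + 1) = e u \<and> y (i + 1, j + 1) = e c)" for a r u c y
  proof -
    have "occurs (w a r u c) y \<longleftrightarrow> (\<exists>v. y v = e a \<and> y (fst v + 1, snd v) = e r \<and>
      y (fst v, snd v + 1) = e u \<and> y (fst v + 1, snd v + 1) = e c)"
      unfolding occurs_def w_def shift_def by (rule ex_cong1) (auto simp: add.commute)
    then show ?thesis by simp
  qed
  have "finite (UNIV :: ('a \<times> 'a \<times> 'a \<times> 'a) set)"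
    using fin by (simp add: finite_Prod_UNIV)
  then have "finite F" unfolding F_def by (meson finite_imageI finite_subset subset_UNIV)
  moreover have "\<forall>p\<in>F. finite (dom p)" by (auto simp: F_def w_def)
  moreover have "Y = {y \<in> fullshift n. \<forall>p\<in>F. \<not> occurs p y}"
  proof -
    have "(\<lambda>u. d (y u)) \<in> window_cfgs R \<longleftrightarrow> (\<forall>p\<in>F. \<not> occurs p y)" if "y \<in> fullshift n" for y
    proof -
      have y: "e (d (y u)) = y u" for u using that ed by (cases u) (simp add: fullshift_def)
      have "(\<forall>p\<in>F. \<not> occurs p y) \<longleftrightarrow> (\<forall>a r u c. occurs (w a r u c) y \<longrightarrow> R a r u c)"
        by (auto simp: F_def)
      also have "\<dots> \<longleftrightarrow> (\<lambda>u. d (y u)) \<in> window_cfgs R"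
      proof
        assume L: "\<forall>a r u c. occurs (w a r u c) y \<longrightarrow> R a r u c"
        have "occurs (w (d (y (i, j))) (d (y (i + 1, j))) (d (y (i, j + 1))) (d (y (i + 1, j + 1)))) y"
          for i j unfolding occ y by blast
        then show "(\<lambda>u. d (y u)) \<in> window_cfgs R" using L by (simp add: window_cfgs_def)
      next
        assume R: "(\<lambda>u. d (y u)) \<in> window_cfgs R"
        show "\<forall>a r u c. occurs (w a r u c) y \<longrightarrow> R a r u c"
        proof (intro allI impI)
          fix a r u c assume "occurs (w a r u c) y"
          then obtain i j where "y (i, j) = e a" "y (i + 1, j) = e r" "y (i, j + 1) = e u"
            "y (i + 1, j + 1) = e c" unfolding occ by blast
          moreover have "R (d (y (i, j))) (d (y (i + 1, j))) (d (y (i, j + 1))) (d (y (i + 1, j + 1)))"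
            using R by (simp add: window_cfgs_def)
          ultimately show "R a r u c" by (simp add: de)
        qed
      qed
      finally show ?thesis by blast
    qed
    then show ?thesis unfolding Y_def by blast
  qed
  ultimately have "is_SFT n Y" unfolding is_SFT_def by blast
  moreover have "block_map Y (\<lambda>y u. f (d (y u)))"
  proof -
    \<comment> \<open>Each output coordinate depends on a single input coordinate, and every
      function on the discrete naturals is continuous.\<close>
    have "continuous_on UNIV ((\<lambda>k. f (d k)) \<circ> (\<lambda>y :: cfg. y u))" for u
      by (intro continuous_on_compose) auto
    then have "continuous_on Y (\<lambda>y. f (d (y u)))" for u
      unfolding comp_def by (rule continuous_on_subset) simp
    then show ?thesis
      unfolding block_map_def shift_def
      by (auto intro!: continuous_on_coordinatewise_then_product)
  qed
  moreover have "(\<lambda>y u. f (d (y u))) ` Y = (\<lambda>z u. f (z u)) ` window_cfgs R"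
  proof
    show "(\<lambda>y u. f (d (y u))) ` Y \<subseteq> (\<lambda>z u. f (z u)) ` window_cfgs R"
      unfolding Y_def by auto
    show "(\<lambda>z u. f (z u)) ` window_cfgs R \<subseteq> (\<lambda>y u. f (d (y u))) ` Y"
    proof
      fix x assume "x \<in> (\<lambda>z u. f (z u)) ` window_cfgs R"
      then obtain z where z: "z \<in> window_cfgs R" "x = (\<lambda>u. f (z u))" by blast
      have "(\<lambda>u. e (z u)) \<in> Y" using z en by (simp add: Y_def fullshift_def de)
      moreover have "x = (\<lambda>u. f (d (e (z u))))" using z by (simp add: de)
      ultimately show "x \<in> (\<lambda>y u. f (d (y u))) ` Y"
        by (intro image_eqI[of _ _ "\<lambda>u. e (z u)"])
    qed
  qed
  moreover have "(\<lambda>z u. f (z u)) ` window_cfgs R \<subseteq> fullshift m"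
    using f by (auto simp: fullshift_def)
  ultimately show ?thesis unfolding sofic_def by metis
qed

text \<open>
  The last five selectors are the fields \<open>bar\<close>, \<open>b\<close>, \<open>E\<close>, \<open>T\<close>, \<open>C\<close> of a tableau; below the base row
  they are unconstrained.
\<close>

datatype cell = Cell (upper: bool) (base: bool) (mark: bool) (barred: bool) (parity: bool)
  (far: bool) (below_top: bool) (carry: bool)

lemma finite_UNIV_cell: "finite (UNIV :: cell set)"
proof -
  have "c \<in> range (\<lambda>(a, b, c, d, e, f, g, h). Cell a b c d e f g h)" for c
    by (rule range_eqI[of _ _ "(upper c, base c, mark c, barred c, parity c, far c, below_top c, carry c)"]) simp
  then have "UNIV = range (\<lambda>(a, b, c, d, e, f, g, h). Cell a b c d e f g h)" by blast
  then show ?thesis by (metis finite finite_imageI)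
qed

text \<open>The arguments are a cell, its right neighbour, its upper neighbour, and the cell diagonally above it.\<close>

definition cell_rule :: "cell \<Rightarrow> cell \<Rightarrow> cell \<Rightarrow> cell \<Rightarrow> bool" where
  "cell_rule a r u c \<longleftrightarrow>
    upper r = upper a \<and> (upper a \<longrightarrow> upper u) \<and> base u = (upper u \<and> \<not> upper a) \<and>
    (base a \<longrightarrow> barred a = mark a \<and> far a \<and> below_top a) \<and>
    (upper a \<longrightarrow>
      mark u = mark a \<and>
      barred u = (barred a \<and> parity a) \<and>
      parity r = (parity a \<noteq> barred r) \<and>
      far c = (\<not> mark a \<and> far a) \<and>
      below_top c = (if mark a then barred u else below_top a) \<and>
      carry r = (if mark a then far a else carry a) \<and>
      (below_top u \<longrightarrow> carry a) \<and> (mark a \<longrightarrow> carry a \<longrightarrow> below_top u))"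

definition visible :: "cell \<Rightarrow> nat" where
  "visible c = (if base c then if mark c then 2 else 1 else 0)"

definition row_cfg :: "int \<Rightarrow> int set \<Rightarrow> cfg" where
  "row_cfg j P = (\<lambda>(x, y). if y = j then if x \<in> P then 2 else 1 else 0)"

definition marks_shift :: "cfg set" where
  "marks_shift = (\<lambda>z u. visible (z u)) ` window_cfgs cell_rule"

text \<open>\<open>upper\<close> is constant along rows and passes upwards, so there is at most one
  base row, and the rows from it on form a tableau. Without a base row only the zero configuration
  is visible, whatever the hidden bits are.\<close>

lemma marks_shift_subset:
  "marks_shift \<subseteq> insert (\<lambda>_. 0) ((\<lambda>(j, P). row_cfg j P) ` (UNIV \<times> tableau_marks))"
proof
  fix y assume "y \<in> marks_shift"
  then obtain z where z: "z \<in> window_cfgs cell_rule" and y: "y = (\<lambda>u. visible (z u))"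
    by (auto simp: marks_shift_def)
  have rule: "cell_rule (z (i, j)) (z (i + 1, j)) (z (i, j + 1)) (z (i + 1, j + 1))" for i j
    using z by (simp add: window_cfgs_def)
  show "y \<in> insert (\<lambda>_. 0) ((\<lambda>(j, P). row_cfg j P) ` (UNIV \<times> tableau_marks))"
  proof (cases "\<exists>u. base (z u)")
    case False
    then have "y = (\<lambda>_. 0)" by (auto simp: y visible_def)
    then show ?thesis by blast
  next
    case True
    then obtain i0 j where ij: "base (z (i0, j))" by auto
    have h1: "upper (z (i + 1, t)) = upper (z (i, t))" for i t
      using rule[of i t] by (simp add: cell_rule_def)
    have h0: "upper (z (i, t)) = upper (z (0, t))" for i t
      by (induction i rule: int_induct[where k = 0]) (use h1 h1[of "_ - 1"] in auto)
    have base: "base (z (i, t)) = (upper (z (0, t)) \<and> \<not> upper (z (0, t - 1)))" for i t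
      using rule[of i "t - 1"] h0[of i t] h0[of i "t - 1"] by (simp add: cell_rule_def)
    have up: "upper (z (0, t + 1))" if "upper (z (0, t))" for t
      using rule[of 0 t] that by (simp add: cell_rule_def)
    have up': "upper (z (0, t))" if "upper (z (0, s))" "s \<le> t" for s t
      using that(2) by (induction t rule: int_ge_induct) (use that up in auto)
    have j: "upper (z (0, j))" "\<not> upper (z (0, j - 1))" using ij base by auto
    have base_iff: "base (z (i, t)) \<longleftrightarrow> t = j" for i t
    proof -
      have "t = j" if "upper (z (0, t))" "\<not> upper (z (0, t - 1))"
        using that j up'[of t "j - 1"] up'[of j "t - 1"] by force
      then show ?thesis using base j by auto
    qed
    have U: "upper (z (i, j + int r))" for i r using up'[OF j(1), of "j + int r"] h0 by auto
    define P where "P = {i. mark (z (i, j))}"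
    have mark: "mark (z (i, j + int r)) \<longleftrightarrow> i \<in> P" for i r
    proof (induction r)
      case (Suc r)
      then show ?case using rule[of i "j + int r"] U[of i r]
        by (simp add: cell_rule_def algebra_simps)
    qed (simp add: P_def)
    have step: "j + int (Suc r) = j + int r + 1" for r by simp
    have "tableau P (\<lambda>i r. barred (z (i, j + int r))) (\<lambda>i r. parity (z (i, j + int r)))
      (\<lambda>i r. far (z (i, j + int r))) (\<lambda>i r. below_top (z (i, j + int r)))
      (\<lambda>i r. carry (z (i, j + int r)))"
    proof
      fix x :: int and r :: nat
      show "barred (z (x, j + int 0)) \<longleftrightarrow> x \<in> P" "far (z (x, j + int 0))" "below_top (z (x, j + int 0))"
        using rule[of x j] base_iff[of x j] by (auto simp: cell_rule_def P_def)
      note R = rule[of x "j + int r", unfolded cell_rule_def, folded step] U[of x r] mark[of x r]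
      show "barred (z (x, j + int (Suc r))) \<longleftrightarrow> barred (z (x, j + int r)) \<and> parity (z (x, j + int r))"
        using R by blast
      show "parity (z (x + 1, j + int r)) \<longleftrightarrow> parity (z (x, j + int r)) \<noteq> barred (z (x + 1, j + int r))"
        using R by blast
      show "far (z (x + 1, j + int (Suc r))) \<longleftrightarrow> x \<notin> P \<and> far (z (x, j + int r))"
        using R by blast
      show "below_top (z (x + 1, j + int (Suc r))) \<longleftrightarrow>
          (if x \<in> P then barred (z (x, j + int (Suc r))) else below_top (z (x, j + int r)))"
        using R by presburger
      show "carry (z (x + 1, j + int r)) \<longleftrightarrow>
          (if x \<in> P then far (z (x, j + int r)) else carry (z (x, j + int r)))"
        using R by presburger
      show "carry (z (x, j + int r))" if "below_top (z (x, j + int (Suc r)))"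
        using R that by blast
      show "below_top (z (x, j + int (Suc r)))" if "x \<in> P" "carry (z (x, j + int r))"
        using R that by blast
    qed
    then have "P \<in> tableau_marks" unfolding tableau_marks_def by blast
    moreover have "y = row_cfg j P"
      using base_iff by (auto simp: y visible_def row_cfg_def P_def)
    ultimately show ?thesis by blast
  qed
qed

lemma row_cfg_in_marks_shift:
  assumes "P \<in> tableau_marks"
  shows "row_cfg 0 P \<in> marks_shift"
proof -
  obtain bar b E T C where "tableau P bar b E T C" using assms unfolding tableau_marks_def by blast
  then interpret tableau P bar b E T C .
  \<comment> \<open>Below row 0 the rule leaves the hidden bits free, so false is a valid
    choice.\<close>
  define z where "z = (\<lambda>(x, t). if t < 0 then Cell False False False False False False False False
    else Cell True (t = 0) (x \<in> P) (bar x (nat t)) (b x (nat t)) (E x (nat t)) (T x (nat t)) (C x (nat t)))"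
  have "cell_rule (z (x, t)) (z (x + 1, t)) (z (x, t + 1)) (z (x + 1, t + 1))" for x t
  proof (cases "t < 0")
    case True
    then show ?thesis by (auto simp: z_def cell_rule_def)
  next
    case False
    then obtain r where r: "t = int r" by (metis nonneg_int_cases not_less)
    have z: "z (x, int r) = Cell True (r = 0) (x \<in> P) (bar x r) (b x r) (E x r) (T x r) (C x r)" for x
      by (simp add: z_def)
    have z': "z (x, int r + 1) = Cell True False (x \<in> P) (bar x (Suc r)) (b x (Suc r)) (E x (Suc r))
        (T x (Suc r)) (C x (Suc r))" for x
      by (simp add: z_def nat_add_distrib)
    have "r = 0 \<Longrightarrow> (bar x r \<longleftrightarrow> x \<in> P) \<and> E x r \<and> T x r" by (simp add: bar_0 E_0 T_0)
    then show ?thesis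
      unfolding r z z' cell_rule_def cell.sel
      using b_step[of x r] E_step[of x r] T_step[of x r] C_step[of x r] bar_Suc[of x r]
        T_imp_C[of x r] C_imp_T[of x r]
      by blast
  qed
  then have "z \<in> window_cfgs cell_rule" by (simp add: window_cfgs_def)
  moreover have "row_cfg 0 P = (\<lambda>u. visible (z u))"
    by (auto simp: row_cfg_def visible_def z_def)
  ultimately show ?thesis unfolding marks_shift_def by blast
qed

section \<open>Binary digit sums\<close>

fun digit_sum :: "nat \<Rightarrow> nat" where
  "digit_sum n = (if n = 0 then 0 else n mod 2 + digit_sum (n div 2))"

declare digit_sum.simps [simp del]

lemma digit_sum_0 [simp]: "digit_sum 0 = 0"
  by (simp add: digit_sum.simps)

lemma digit_sum_double [simp]: "digit_sum (2 * n) = digit_sum n"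
  by (cases "n = 0") (simp_all add: digit_sum.simps[of "2 * n"])

lemma digit_sum_Suc_double [simp]: "digit_sum (Suc (2 * n)) = Suc (digit_sum n)"
  by (simp add: digit_sum.simps[of "Suc (2 * n)"])

text \<open>\<open>v\<close> is the 2-adic valuation of \<open>Suc m\<close>.\<close>

lemma digit_sum_valuation:
  "\<exists>v. (\<forall>k. 2 ^ k dvd Suc m \<longleftrightarrow> k \<le> v) \<and> digit_sum (Suc m) + v = digit_sum m + 1"
proof (induction m rule: less_induct)
  case (less m)
  show ?case
  proof (cases "even m")
    case True
    then obtain n where n: "m = 2 * n" by blast
    have "2 ^ k dvd Suc m \<longleftrightarrow> k \<le> 0" for k
      using True by (cases k) (auto dest: dvd_mult_left)
    then show ?thesis using n by (intro exI[of _ 0]) simp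
  next
    case False
    then obtain n where n: "m = Suc (2 * n)" by (auto elim: oddE)
    then obtain v where v: "\<forall>k. 2 ^ k dvd Suc n \<longleftrightarrow> k \<le> v" "digit_sum (Suc n) + v = digit_sum n + 1"
      using less[of n] by auto
    have m: "Suc m = 2 * Suc n" using n by simp
    have "2 ^ k dvd Suc m \<longleftrightarrow> k \<le> Suc v" for k
    proof (cases k)
      case (Suc l)
      have "2 * 2 ^ l dvd 2 * Suc n \<longleftrightarrow> 2 ^ l dvd Suc n" by (rule dvd_times_left_cancel_iff) simp
      then show ?thesis unfolding m Suc power_Suc using v(1) by simp
    qed simp
    moreover have "digit_sum (Suc m) + Suc v = digit_sum m + 1"
      unfolding m digit_sum_double using v(2) n by simp
    ultimately show ?thesis by blast
  qed
qed

text \<open>Adding \<open>2 ^ d\<close> puts a new digit one in front of \<open>m\<close>; the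
  induction strips the last digit.\<close>

lemma digit_sum_add_power:
  "m < 2 ^ d \<Longrightarrow> digit_sum (2 ^ d + m) = Suc (digit_sum m)"
proof (induction d arbitrary: m)
  case 0
  then show ?case using digit_sum_Suc_double[of 0] by simp
next
  case (Suc d)
  have IH: "digit_sum (2 ^ d + m div 2) = Suc (digit_sum (m div 2))" using Suc by auto
  show ?case
  proof (cases "even m")
    case True
    then obtain n where n: "m = 2 * n" by blast
    have "digit_sum (2 * (2 ^ d + n)) = Suc (digit_sum (2 * n))"
      unfolding digit_sum_double using IH n by simp
    then show ?thesis unfolding n by (simp only: power_Suc distrib_left)
  next
    case False
    then obtain n where n: "m = Suc (2 * n)" by (auto elim: oddE)
    have "digit_sum (Suc (2 * (2 ^ d + n))) = Suc (digit_sum (Suc (2 * n)))"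
      unfolding digit_sum_Suc_double using IH n by simp
    then show ?thesis unfolding n by (simp only: power_Suc distrib_left add_Suc_right)
  qed
qed

lemma digit_sum_power_minus_1: "digit_sum (2 ^ d - 1) = d"
proof (induction d)
  case (Suc d)
  have "(2 :: nat) ^ Suc d - 1 = Suc (2 * (2 ^ d - 1))" using one_le_power[of "2 :: nat" d]
    unfolding power_Suc by linarith
  then show ?case using Suc by simp
qed simp

text \<open>\<open>pos i m\<close> is the column of mark number \<open>m\<close> of \<open>x\<^sub>i\<close>.\<close>

definition pos :: "nat \<Rightarrow> nat \<Rightarrow> int" where
  "pos i m = (\<Sum>k<m. int (digit_sum k + 1 + i))"

lemma pos_0 [simp]: "pos i 0 = 0"
  by (simp add: pos_def)

lemma pos_Suc: "pos i (Suc m) = pos i m + int (digit_sum m + 1 + i)"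
  by (simp add: pos_def)

lemma strict_mono_pos: "strict_mono (pos i)"
  by (rule strict_mono_Suc_iff[THEN iffD2]) (simp add: pos_Suc)

lemma pos_less_iff [simp]: "pos i m < pos i n \<longleftrightarrow> m < n"
  by (rule strict_mono_less[OF strict_mono_pos])

lemma pos_le_iff [simp]: "pos i m \<le> pos i n \<longleftrightarrow> m \<le> n"
  by (rule strict_mono_less_eq[OF strict_mono_pos])

lemma pos_eq_iff [simp]: "pos i m = pos i n \<longleftrightarrow> m = n"
  by (rule strict_mono_eq[OF strict_mono_pos])

lemma pos_ge: "int m \<le> pos i m"
  by (induction m) (auto simp: pos_Suc)

lemma pos_interval_cases:
  obtains "x < 0" | m where "pos i m \<le> x" "x < pos i (Suc m)"
proof (cases "x < 0")
  case False
  define m where "m = (LEAST m. x < pos i (Suc m))"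
  have "x < pos i (Suc (nat x))" using pos_ge[of "Suc (nat x)" i] False by simp
  then have m: "x < pos i (Suc m)" unfolding m_def by (rule LeastI)
  have "pos i m \<le> x"
  proof (cases m)
    case (Suc n)
    then have "\<not> x < pos i (Suc n)" using not_less_Least[of n "\<lambda>m. x < pos i (Suc m)"] m_def by auto
    then show ?thesis using Suc by simp
  qed (use False in simp)
  then show ?thesis using that m by blast
qed (use that in blast)

lemma pos_interval_unique:
  assumes "pos i m \<le> x" "x < pos i (Suc m)" "pos i n \<le> x" "x < pos i (Suc n)"
  shows "m = n"
proof -
  have "pos i m < pos i (Suc n)" "pos i n < pos i (Suc m)" using assms by linarith+
  then show ?thesis by simp
qed

text \<open>The quotient by \<open>2 ^ r\<close> grows by one exactly at multiples of
  \<open>2 ^ r\<close>. This is the flipping rule \<open>b_step\<close> for numbered marks.\<close>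

lemma even_div_power_Suc:
  "even (Suc m div 2 ^ r) \<longleftrightarrow> even (m div 2 ^ r) \<noteq> (2 ^ r dvd Suc m)"
  by (cases "2 ^ r dvd Suc m") (simp_all add: div_Suc mod_eq_0_iff_dvd)

text \<open>The counterpart of \<open>bar_Suc\<close>: a bar continues if digit \<open>r\<close> of
  its number is zero.\<close>

lemma power_Suc_dvd_iff:
  "2 ^ Suc r dvd m \<longleftrightarrow> 2 ^ r dvd m \<and> even (m div 2 ^ r)" for m :: nat
proof
  assume "2 ^ Suc r dvd m"
  then obtain k where "m = 2 ^ Suc r * k" by blast
  then have "m = 2 ^ r * (2 * k)" by simp
  then show "2 ^ r dvd m \<and> even (m div 2 ^ r)" by simp
next
  assume "2 ^ r dvd m \<and> even (m div 2 ^ r)"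
  then obtain k l where "m = 2 ^ r * k" "m div 2 ^ r = 2 * l" by blast
  then have "m = 2 ^ Suc r * l" by simp
  then show "2 ^ Suc r dvd m" by (rule dvdI)
qed

lemma range_pos_in_tableau_marks: "range (pos i) \<in> tableau_marks"
proof -
  define P where "P = range (pos i)"
  define bar where "bar x r \<longleftrightarrow> (\<exists>m. x = pos i m \<and> 2 ^ r dvd m)" for x and r :: nat
  \<comment> \<open>Digit \<open>r\<close> of the number of the last mark at or before
    \<open>x\<close> is zero. The value is false left of mark 0, so that it flips at mark 0 on every
    level.\<close>
  define b where "b x r \<longleftrightarrow> (\<exists>m. pos i m \<le> x \<and> x < pos i (Suc m) \<and> even (m div 2 ^ r))" for x and r :: nat
  define E where "E x r \<longleftrightarrow> (\<forall>k. 1 \<le> k \<and> k \<le> r \<longrightarrow> x - int k \<notin> P)" for x and r :: nat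
  \<comment> \<open>At most one \<open>m\<close> qualifies, and none if \<open>x \<le> 0\<close>,
    where \<open>T\<close> and \<open>C\<close> are therefore true. \<open>nat\<close> cuts negative
    exponents off at 0, matching the truncated subtraction in \<open>T_after\<close>.\<close>
  define T where "T x r \<longleftrightarrow> (\<forall>m. pos i m < x \<and> x \<le> pos i (Suc m) \<longrightarrow> 2 ^ nat (int r + 1 - (x - pos i m)) dvd m)"
    for x and r :: nat
  define C where "C x r \<longleftrightarrow> (\<forall>m. pos i m < x \<and> x \<le> pos i (Suc m) \<longrightarrow> E (pos i m) r)" for x and r :: nat
  have pos_nonneg: "0 \<le> pos i m" for m using pos_ge[of m i] by linarith
  have notP: "x \<notin> P" if "pos i m < x" "x < pos i (Suc m)" for x m
  proof
    assume "x \<in> P"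
    then obtain n where "x = pos i n" by (auto simp: P_def)
    then show False using that by simp
  qed
  have negP: "x \<notin> P" if "x < 0" for x using that pos_nonneg unfolding P_def by (auto simp: not_le[symmetric])
  have bar_iff: "bar (pos i m) r \<longleftrightarrow> 2 ^ r dvd m" for m r by (auto simp: bar_def)
  have b_iff: "b x r \<longleftrightarrow> even (m div 2 ^ r)" if "pos i m \<le> x" "x < pos i (Suc m)" for x m r
    unfolding b_def using that pos_interval_unique[OF that] by blast
  have b_neg: "\<not> b x r" if "x < 0" for x r
    unfolding b_def using that pos_nonneg by (meson leD order_trans)
  have T_iff: "T (x + 1) r \<longleftrightarrow> 2 ^ nat (int r - (x - pos i m)) dvd m"
    if "pos i m \<le> x" "x < pos i (Suc m)" for x m r
  proof -
    have "pos i n < x + 1 \<and> x + 1 \<le> pos i (Suc n) \<longleftrightarrow> n = m" for n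
      unfolding zle_add1_eq_le add1_zle_eq using that pos_interval_unique[OF that] by blast
    then show ?thesis unfolding T_def by (simp add: algebra_simps)
  qed
  have C_iff: "C (x + 1) r \<longleftrightarrow> E (pos i m) r"
    if "pos i m \<le> x" "x < pos i (Suc m)" for x m r
  proof -
    have "pos i n < x + 1 \<and> x + 1 \<le> pos i (Suc n) \<longleftrightarrow> n = m" for n
      unfolding zle_add1_eq_le add1_zle_eq using that pos_interval_unique[OF that] by blast
    then show ?thesis unfolding C_def by simp
  qed
  have TC_neg: "T x r" "C x r" if "x \<le> 0" for x r
    unfolding T_def C_def using that pos_nonneg by (meson leD order_trans)+
  have E_first: "E (pos i 0) r" for r using negP by (auto simp: E_def)
  have E_later: "E (pos i (Suc m)) r \<longleftrightarrow> r < digit_sum m + 1 + i" for m r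
  proof -
    let ?g = "digit_sum m + 1 + i"
    have "pos i (Suc m) - int ?g \<in> P" by (simp add: pos_Suc P_def)
    moreover have "pos i (Suc m) - int k \<notin> P" if "1 \<le> k" "k < ?g" for k
      by (rule notP[of m]) (use that in \<open>auto simp: pos_Suc\<close>)
    ultimately show ?thesis unfolding E_def
      by (metis le_less_trans not_le le_add1 le_add2 add.assoc add.commute)
  qed
  have "tableau P bar b E T C"
  proof
    fix x :: int and r :: nat
    show "bar x 0 \<longleftrightarrow> x \<in> P" by (auto simp: bar_def P_def)
    show "E x 0" by (simp add: E_def)
    show "T x 0" by (simp add: T_def)
    show "bar x (Suc r) \<longleftrightarrow> bar x r \<and> b x r"
    proof (cases "x \<in> P")
      case True
      then obtain m where m: "x = pos i m" by (auto simp: P_def)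
      then have "b x r \<longleftrightarrow> even (m div 2 ^ r)" by (intro b_iff) auto
      then show ?thesis unfolding m bar_iff using power_Suc_dvd_iff[of r m] by simp
    next
      case False
      then show ?thesis by (auto simp: bar_def P_def)
    qed
    show "b (x + 1) r \<longleftrightarrow> b x r \<noteq> bar (x + 1) r"
    proof (cases rule: pos_interval_cases[where x = x and i = i])
      case 1
      show ?thesis
      proof (cases "x + 1 = 0")
        case True
        have "b 0 r" using b_iff[of 0 0 r] by (simp add: pos_Suc)
        moreover have "bar 0 r" using bar_iff[of 0 r] by simp
        ultimately show ?thesis using True b_neg[OF 1] by simp
      next
        case False
        then have "x + 1 < 0" using 1 by simp
        moreover from this have "\<not> bar (x + 1) r" using negP by (auto simp: bar_def P_def)
        ultimately show ?thesis using b_neg 1 by simp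
      qed
    next
      case (2 m)
      show ?thesis
      proof (cases "x + 1 = pos i (Suc m)")
        case True
        have "b (x + 1) r \<longleftrightarrow> even (Suc m div 2 ^ r)" by (rule b_iff) (simp_all add: True)
        moreover have "bar (x + 1) r \<longleftrightarrow> 2 ^ r dvd Suc m" using True bar_iff by metis
        ultimately show ?thesis using even_div_power_Suc[of m r] b_iff[OF 2, of r] by simp
      next
        case False
        then have m: "pos i m < x + 1" "x + 1 < pos i (Suc m)" using 2 by auto
        then have "\<not> bar (x + 1) r" using notP[OF m] by (auto simp: bar_def P_def)
        then show ?thesis using b_iff[OF 2, of r] b_iff[of m "x + 1" r] m by auto
      qed
    qed
    show "E (x + 1) (Suc r) \<longleftrightarrow> x \<notin> P \<and> E x r"
    proof
      assume a: "E (x + 1) (Suc r)"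
      have "x + 1 - int (Suc k) \<notin> P" if "k \<le> r" for k using a that unfolding E_def by auto
      then have k: "x - int k \<notin> P" if "k \<le> r" for k using that by simp
      then show "x \<notin> P \<and> E x r" using k[of 0] by (auto simp: E_def)
    next
      assume a: "x \<notin> P \<and> E x r"
      have "x - int k \<notin> P" if "k \<le> r" for k using a that by (cases k) (auto simp: E_def)
      then have k: "x + 1 - int (Suc k) \<notin> P" if "k \<le> r" for k using that by simp
      show "E (x + 1) (Suc r)" unfolding E_def
      proof (intro allI impI)
        fix k :: nat assume "1 \<le> k \<and> k \<le> Suc r"
        then have "Suc (k - 1) = k" "k - 1 \<le> r" by auto
        then show "x + 1 - int k \<notin> P" using k[of "k - 1"] by simp
      qed
    qed
    show "T (x + 1) (Suc r) \<longleftrightarrow> (if x \<in> P then bar x (Suc r) else T x r)"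
    proof (cases rule: pos_interval_cases[where x = x and i = i])
      case 1
      then show ?thesis using negP TC_neg by simp
    next
      case (2 m)
      note T2 = T_iff[OF 2, of "Suc r"]
      show ?thesis
      proof (cases "x = pos i m")
        case True
        then have "x \<in> P" by (simp add: P_def)
        then show ?thesis using T2 True bar_iff[of m "Suc r"] by (simp add: nat_add_distrib)
      next
        case False
        then have "x \<notin> P" using notP[of m x] 2 by simp
        moreover have "T x r \<longleftrightarrow> 2 ^ nat (int r - (x - 1 - pos i m)) dvd m"
          using T_iff[of m "x - 1" r] 2 False by simp
        ultimately show ?thesis using T2 by (simp add: algebra_simps)
      qed
    qed
    show "C (x + 1) r \<longleftrightarrow> (if x \<in> P then E x r else C x r)"
    proof (cases rule: pos_interval_cases[where x = x and i = i])
      case 1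
      then show ?thesis using negP TC_neg by simp
    next
      case (2 m)
      show ?thesis
      proof (cases "x = pos i m")
        case True
        then have "x \<in> P" by (simp add: P_def)
        then show ?thesis using C_iff[OF 2] True by simp
      next
        case False
        then have "x \<notin> P" using notP[of m x] 2 by simp
        then show ?thesis using C_iff[OF 2] C_iff[of m "x - 1" r] 2 False by simp
      qed
    qed
    show "C x r" if "T x (Suc r)"
      unfolding C_def
    proof (intro allI impI)
      fix m assume m: "pos i m < x \<and> x \<le> pos i (Suc m)"
      show "E (pos i m) r"
      proof (cases m)
        case 0
        then show ?thesis using E_first by simp
      next
        case (Suc n)
        obtain v where v: "\<forall>k. 2 ^ k dvd m \<longleftrightarrow> k \<le> v" "digit_sum m + v = digit_sum n + 1"
          using digit_sum_valuation[of n] Suc by blast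
        have "2 ^ nat (int (Suc r) + 1 - (x - pos i m)) dvd m" using that m unfolding T_def by blast
        then have "nat (int (Suc r) + 1 - (x - pos i m)) \<le> v" using v by blast
        \<comment> \<open>\<open>T\<close> weakens as \<open>x\<close> moves right, so the next mark
          is the critical column; there the bound is the valuation identity.\<close>
        then have "r < digit_sum n + 1 + i" using m v(2) unfolding pos_Suc nat_le_iff by linarith
        then show ?thesis using E_later Suc by simp
      qed
    qed
    show "T x (Suc r)" if "x \<in> P" "C x r"
      unfolding T_def
    proof (intro allI impI)
      fix m assume m: "pos i m < x \<and> x \<le> pos i (Suc m)"
      \<comment> \<open>A mark in this interval is its right end, where the estimate is sharp and
        can be reversed.\<close>
      have x: "x = pos i (Suc m)" using notP[of m x] m that(1) by force
      show "2 ^ nat (int (Suc r) + 1 - (x - pos i m)) dvd m"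
      proof (cases m)
        case (Suc n)
        obtain v where v: "\<forall>k. 2 ^ k dvd m \<longleftrightarrow> k \<le> v" "digit_sum m + v = digit_sum n + 1"
          using digit_sum_valuation[of n] Suc by blast
        have "E (pos i m) r" using that(2) m unfolding C_def by blast
        then have "r < digit_sum n + 1 + i" using E_later Suc by simp
        then have "nat (int (Suc r) + 1 - (x - pos i m)) \<le> v"
          using v(2) unfolding x pos_Suc nat_le_iff by linarith
        then show ?thesis using v by blast
      qed simp
    qed
  qed
  then show ?thesis unfolding tableau_marks_def P_def by blast
qed

section \<open>The descending chain\<close>

text \<open>The distances following marks \<open>2 ^ d + k\<close> are those of \<open>Suc i\<close>
  following marks \<open>k\<close>. Only \<open>k < m\<close> enter, so \<open>m = 2 ^ d\<close> is
  allowed.\<close>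

lemma pos_add_power:
  assumes "m \<le> 2 ^ d"
  shows "pos i (2 ^ d + m) = pos i (2 ^ d) + pos (Suc i) m"
  using assms
proof (induction m)
  case (Suc m)
  then show ?case by (simp add: pos_Suc digit_sum_add_power)
qed simp

text \<open>In the window of radius \<open>d\<close> around mark \<open>2 ^ d\<close> the left half
  is blank, as the preceding mark is \<open>d + 1 + i\<close> columns away. Since marks are at least
  one column apart, the right half only meets numbers covered by
  \<open>pos_add_power\<close>.\<close>

lemma range_pos_shift:
  assumes "- int d \<le> x" "x \<le> int d"
  shows "pos i (2 ^ d) + x \<in> range (pos i) \<longleftrightarrow> x \<in> range (pos (Suc i))"
proof
  assume "x \<in> range (pos (Suc i))"
  then obtain m where m: "x = pos (Suc i) m" by blast
  then have "int m \<le> int d" using pos_ge[of m "Suc i"] assms by linarith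
  then have "m \<le> 2 ^ d" using less_exp[of d] by linarith
  then show "pos i (2 ^ d) + x \<in> range (pos i)" using pos_add_power m by (metis rangeI)
next
  assume "pos i (2 ^ d) + x \<in> range (pos i)"
  then obtain n where n: "pos i (2 ^ d) + x = pos i n" by blast
  obtain k where k: "(2 :: nat) ^ d = Suc k" "k = 2 ^ d - 1" by (metis Suc_pred' zero_less_numeral zero_less_power diff_Suc_1)
  have "pos i (2 ^ d) = pos i k + int (d + 1 + i)"
    unfolding k(1) pos_Suc using digit_sum_power_minus_1[of d] k(2) by simp
  then have "pos i k < pos i n" using n assms by linarith
  then have "2 ^ d \<le> n" using k(1) by simp
  then obtain m where m: "n = 2 ^ d + m" using le_Suc_ex by blast
  have "m \<le> 2 ^ d"
  proof (rule ccontr)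
    assume "\<not> m \<le> 2 ^ d"
    then have "pos i (2 ^ d + 2 ^ d) < pos i n" using m by simp
    then have "pos (Suc i) (2 ^ d) < x" using pos_add_power[of "2 ^ d" d i] n by simp
    moreover have "int d < int (2 ^ d)" using less_exp[of d] by linarith
    ultimately show False using pos_ge[of "2 ^ d" "Suc i"] assms by linarith
  qed
  then show "x \<in> range (pos (Suc i))" using pos_add_power[of m d i] n m by auto
qed

lemma subpat_gt_row_cfg_pos:
  "subpat_gt (row_cfg 0 (range (pos i))) (row_cfg 0 (range (pos (Suc i))))"
  unfolding subpat_gt_def
proof
  let ?x = "row_cfg 0 (range (pos i))" and ?y = "row_cfg 0 (range (pos (Suc i)))"
  show "subpat_ge ?x ?y"
    unfolding subpat_ge_def
  proof (intro allI impI)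
    fix p :: "int \<times> int \<rightharpoonup> nat"
    assume fin: "finite (dom p)" and "occurs p ?y"
    then obtain v where v: "\<And>u. u \<in> dom p \<Longrightarrow> p u = Some (shift v ?y u)" unfolding occurs_def by blast
    \<comment> \<open>A crude bound on the columns that the finite pattern meets.\<close>
    define d where "d = (\<Sum>u\<in>dom p. nat \<bar>fst u + fst v\<bar>)"
    have d: "\<bar>fst u + fst v\<bar> \<le> int d" if "u \<in> dom p" for u
      using member_le_sum[OF that, of "\<lambda>u. nat \<bar>fst u + fst v\<bar>"] fin unfolding d_def by linarith
    have "p u = Some (shift (pos i (2 ^ d) + fst v, snd v) ?x u)" if u: "u \<in> dom p" for u
    proof -
      obtain a c where ac: "u = (a, c)" by fastforce
      have "pos i (2 ^ d) + (a + fst v) \<in> range (pos i) \<longleftrightarrow> a + fst v \<in> range (pos (Suc i))"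
        by (rule range_pos_shift) (use d[OF u] ac in auto)
      moreover have "pos i (2 ^ d) + (a + fst v) = a + (pos i (2 ^ d) + fst v)" by simp
      ultimately show ?thesis using v[OF u] unfolding ac shift_def row_cfg_def by simp
    qed
    then show "occurs p ?x" unfolding occurs_def by blast
  qed
  show "\<not> subpat_ge ?y ?x"
  proof
    assume ge: "subpat_ge ?y ?x"
    let ?p = "[(0 :: int, 0 :: int) \<mapsto> 2 :: nat, (int (Suc i), 0) \<mapsto> 2]"
    have "0 \<in> range (pos i)" "int (Suc i) \<in> range (pos i)"
      using rangeI[of "pos i" 0] rangeI[of "pos i" 1] pos_Suc[of i 0] by (auto simp: add.commute)
    then have "occurs ?p ?x" unfolding occurs_def
      by (intro exI[of _ "(0, 0)"]) (auto simp: shift_def row_cfg_def)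
    then have "occurs ?p ?y" using ge unfolding subpat_ge_def by auto
    then obtain v where v: "\<forall>u\<in>dom ?p. ?p u = Some (shift v ?y u)" unfolding occurs_def by blast
    have "shift v ?y (0, 0) = 2" "shift v ?y (int (Suc i), 0) = 2"
      using v by (auto split: if_splits)
    then have "fst v \<in> range (pos (Suc i))" "int (Suc i) + fst v \<in> range (pos (Suc i))"
      unfolding shift_def row_cfg_def by (auto split: if_splits)
    then obtain m n where mn: "fst v = pos (Suc i) m" "int (Suc i) + fst v = pos (Suc i) n" by blast
    then have "pos (Suc i) m < pos (Suc i) n" by linarith
    \<comment> \<open>The two marks need not be consecutive, but already the mark after number
      \<open>m\<close> is at least \<open>i + 2\<close> columns away.\<close>
    then have "pos (Suc i) (Suc m) \<le> pos (Suc i) n" by simp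
    then show False using mn by (simp add: pos_Suc)
  qed
qed

theorem theorem17:
  shows "\<exists>m X (x :: nat \<Rightarrow> cfg). sofic m X \<and> countable X \<and> (\<forall>i. x i \<in> X) \<and>
           (\<forall>i. subpat_gt (x i) (x (Suc i)))"
proof (intro exI conjI allI)
  \<comment> \<open>Three visible symbols: background, blank base cell, mark.\<close>
  show "sofic 3 marks_shift"
    unfolding marks_shift_def
    by (rule sofic_window_cfgs[OF finite_UNIV_cell]) (simp add: visible_def)
  show "countable marks_shift"
    by (rule countable_subset[OF marks_shift_subset]) (simp add: countable_tableau_marks)
  show "row_cfg 0 (range (pos i)) \<in> marks_shift" for i
    by (rule row_cfg_in_marks_shift[OF range_pos_in_tableau_marks])
  show "subpat_gt (row_cfg 0 (range (pos i))) (row_cfg 0 (range (pos (Suc i))))" for i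
    by (rule subpat_gt_row_cfg_pos)
qed

end
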